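(* Let $(\mathscr{G},\sigma)$ be a braided dynamical group over $\Lambda$, with $\mathscr{G}=(G,\Lambda,\phi_G)$ and $\sigma(\lambda,a,b)=(a\rightharpoonup_\lambda b,\ a\leftharpoonup_\lambda b)$. Let $Q(\mathscr{G})$ be the quiver $\Lambda\times G$ over $\Lambda$ with source $\alpha(\lambda,a)=\lambda$ and target $\beta(\lambda,a)=\phi_G(\lambda,a)$, and define $\hat\sigma:Q(\mathscr{G})_\beta\times_\alpha Q(\mathscr{G})\to Q(\mathscr{G})_\beta\times_\alpha Q(\mathscr{G})$ by $$\hat\sigma\big((\lambda,a),(\lambda',b)\big)=\big((\lambda,a\rightharpoonup_\lambda b),\ (\phi_G(\lambda,a\rightharpoonup_\lambda b),a\leftharpoonup_\lambda b)\big),\qquad \lambda'=\phi_G(\lambda,a).$$ Then $\hat\sigma$ is a non-degenerate quiver-theoretical solution of the Yang-Baxter equation on the quiver $Q(\mathscr{G})$. Moreover, the two constructions of a quiver-theoretical solution from $(\mathscr{G},\sigma)$ agree: the solution $\hat\sigma$ (obtained by passing to the braided groupoid $(Q(\mathscr{G}),\hat\sigma)$ and taking its braiding) equals the solution $\widetilde\sigma=(Q^{(2)}_{G,G})^{-1}\circ Q(\sigma)\circ Q^{(2)}_{G,G}$ (obtained by regarding $\sigma$ as a solution of the dynamical Yang-Baxter equation on $\mathscr{G}$ and applying the functor $Q$).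
   Context: Fix a non-empty set $\Lambda$. A dynamical set is a triple $\mathscr{X}=(X,\Lambda,\phi_X)$ with $X$ a set and $\phi_X:\Lambda\times X\to\Lambda$ a map. A morphism $\mathscr{X}\to\mathscr{Y}$ is a map $f:\Lambda\times X\to Y$ with $\phi_Y(\lambda,f(\lambda,x))=\phi_X(\lambda,x)$. The tensor product is $\mathscr{X}\otimes\mathscr{Y}=(X\times Y,\Lambda,\phi_{X\times Y})$, $\phi_{X\times Y}(\lambda,x,y)=\phi_Y(\phi_X(\lambda,x),y)$. Functor $Q$: $Q(\mathscr{X})$ is the quiver $\Lambda\times X$ over $\Lambda$ with source $\alpha(\lambda,x)=\lambda$ and target $\beta(\lambda,x)=\phi_X(\lambda,x)$; for a morphism $f:\mathscr{X}\to\mathscr{Y}$, $Q(f)(\lambda,x)=(\lambda,f(\lambda,x))$. Put $Q^{(2)}_{X,X}:Q(\mathscr{X})_\beta\times_\alpha Q(\mathscr{X})\to Q(\mathscr{X}\otimes\mathscr{X})$, $((\lambda,x),(\phi_X(\lambda,x),y))\mapsto(\lambda,x,y)$, a bijection. Dynamical group: a dynamical set $\mathscr{G}=(G,\Lambda,\phi_G)$ with maps $\circ_\lambda:G\times G\to G$ ($\lambda\in\Lambda$) such that $\phi_G(\lambda,a\circ_\lambda b)=\phi_G(\phi_G(\lambda,a),b)$ and $a\circ_\lambda(b\circ_{\phi_G(\lambda,a)}c)=(a\circ_\lambda b)\circ_\lambda c$; an element $e_G\in G$ with $a\circ_\lambda e_G=e_G\circ_\lambda a=a$ and $\phi_G(\lambda,e_G)=\lambda$;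 and for all $\lambda,a$ an element $\bar a^\lambda\in G$ with $a\circ_\lambda\bar a^\lambda=\bar a^\lambda\circ_{\phi_G(\lambda,a)}a=e_G$. Matched pair of dynamical groups $(\mathscr{G},\mathscr{H},\sigma)$: dynamical groups $(\mathscr{G},\circ)$, $(\mathscr{H},\cdot)$ and a map $\sigma:\Lambda\times G\times H\to H\times G$, written $\sigma(\lambda,a,x)=(a\rightharpoonup_\lambda x,\ a\leftharpoonup_\lambda x)$ (the subscript is the first argument of $\sigma$), which is a morphism $\mathscr{G}\otimes\mathscr{H}\to\mathscr{H}\otimes\mathscr{G}$, i.e. $\phi_G(\phi_H(\lambda,a\rightharpoonup_\lambda x),a\leftharpoonup_\lambda x)=\phi_H(\phi_G(\lambda,a),x)$, such that for all $\lambda\in\Lambda$, $a,b\in G$, $x,y\in H$: (1) $e_G\rightharpoonup_\lambda x=x$; (2) $(a\circ_\lambda b)\rightharpoonup_\lambda x=a\rightharpoonup_\lambda(b\rightharpoonup_{\phi_G(\lambda,a)}x)$; (3) $a\rightharpoonup_\lambda(x\cdot_{\phi_G(\lambda,a)}y)=(a\rightharpoonup_\lambda x)\cdot_\lambda\big((a\leftharpoonup_\lambda x)\rightharpoonup_{\phi_H(\lambda,a\rightharpoonup_\lambda x)}y\big)$; (4) $a\leftharpoonup_\lambda e_H=a$; (5) $a\leftharpoonup_\lambda(x\cdot_{\phi_G(\lambda,a)}y)=(a\leftharpoonup_\lambda x)\leftharpoonup_{\phi_H(\lambda,a\rightharpoonup_\lambda x)}y$; (6) $(a\circ_\lambda b)\leftharpoonup_\lambda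 x=\big(a\leftharpoonup_\lambda(b\rightharpoonup_{\phi_G(\lambda,a)}x)\big)\circ_{\phi_H(\lambda,(a\circ_\lambda b)\rightharpoonup_\lambda x)}(b\leftharpoonup_{\phi_G(\lambda,a)}x)$. Braided dynamical group $(\mathscr{G},\sigma)$: a dynamical group $(\mathscr{G},\circ)$ with $\sigma:\Lambda\times G\times G\to G\times G$ such that $(\mathscr{G},\mathscr{G},\sigma)$ is a matched pair of dynamical groups and $(a\rightharpoonup_\lambda b)\circ_\lambda(a\leftharpoonup_\lambda b)=a\circ_\lambda b$ for all $\lambda,a,b$. Quiver-theoretical solution of the Yang-Baxter equation on a quiver $\mathbb{A}$ over $\Lambda$ (source $\alpha$, target $\beta$): a quiver isomorphism $R:\mathbb{A}_\beta\times_\alpha\mathbb{A}\to\mathbb{A}_\beta\times_\alpha\mathbb{A}$ (a bijection preserving the source of the first and the target of the second arrow of a composable pair) with $R_{12}R_{23}R_{12}=R_{23}R_{12}R_{23}$ on $\mathbb{A}_\beta\times_\alpha\mathbb{A}_\beta\times_\alpha\mathbb{A}$, where $R_{12}=R\times\mathrm{Id}$, $R_{23}=\mathrm{Id}\times R$. Writing $R(x,y)=(x\rightharpoonup y,x\leftharpoonup y)$, it is non-degenerate if for every arrow $x$ the map $x\rightharpoonup-:\alpha^{-1}(\beta(x))\to\alpha^{-1}(\alpha(x))$ is bijective and for every arrow $y$ the map $-\leftharpoonup y:\beta^{-1}(\alpha(y))\to\beta^{-1}(\beta(y))$ is bijective. *)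

theory Defs
  imports Graph_Theory.Digraph "HOL-Library.FuncSet"
begin

section \<open>Dynamical sets\<close>

text \<open>
  The set \<open>\<Lambda>\<close> is fixed throughout and is passed as a separate parameter; a dynamical set
  over \<open>\<Lambda>\<close> is then given by its underlying set and its structure map. As everywhere below,
  only the values on the carriers matter.
\<close>

record ('l, 'x) dynset =
  pts :: "'x set"
  act :: "'l \<times> 'x \<Rightarrow> 'l"

locale dynamical_set =
  fixes \<Lambda> :: "'l set" and X :: "('l, 'x, 'm) dynset_scheme"
  assumes nonempty: "\<Lambda> \<noteq> {}"
    and act_closed: "act X \<in> \<Lambda> \<times> pts X \<rightarrow> \<Lambda>"

definition dyn_morphism ::
  "'l set \<Rightarrow> ('l, 'x, 'm) dynset_scheme \<Rightarrow> ('l, 'y, 'n) dynset_scheme \<Rightarrow> ('l \<times> 'x \<Rightarrow> 'y) \<Rightarrow> bool"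
  where "dyn_morphism \<Lambda> X Y f \<longleftrightarrow>
    f \<in> \<Lambda> \<times> pts X \<rightarrow> pts Y \<and>
    (\<forall>l\<in>\<Lambda>. \<forall>x\<in>pts X. act Y (l, f (l, x)) = act X (l, x))"

definition tensor ::
  "('l, 'x, 'm) dynset_scheme \<Rightarrow> ('l, 'y, 'n) dynset_scheme \<Rightarrow> ('l, 'x \<times> 'y) dynset"
  where "tensor X Y =
    \<lparr>pts = pts X \<times> pts Y, act = (\<lambda>(l, x, y). act Y (act X (l, x), y))\<rparr>"


section \<open>Braided dynamical groups\<close>

record ('l, 'x) dyngroup = "('l, 'x) dynset" +
  mul :: "'l \<Rightarrow> 'x \<Rightarrow> 'x \<Rightarrow> 'x"
  unit :: 'x

locale dynamical_group = dynamical_set \<Lambda> G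
  for \<Lambda> :: "'l set" and G :: "('l, 'g, 'm) dyngroup_scheme" +
  assumes mul_closed: "\<lbrakk>l \<in> \<Lambda>; a \<in> pts G; b \<in> pts G\<rbrakk> \<Longrightarrow> mul G l a b \<in> pts G"
    and act_mul: "\<lbrakk>l \<in> \<Lambda>; a \<in> pts G; b \<in> pts G\<rbrakk> \<Longrightarrow>
      act G (l, mul G l a b) = act G (act G (l, a), b)"
    and mul_assoc: "\<lbrakk>l \<in> \<Lambda>; a \<in> pts G; b \<in> pts G; c \<in> pts G\<rbrakk> \<Longrightarrow>
      mul G l a (mul G (act G (l, a)) b c) = mul G l (mul G l a b) c"
    and unit_closed: "unit G \<in> pts G"
    and mul_unit_right: "\<lbrakk>l \<in> \<Lambda>; a \<in> pts G\<rbrakk> \<Longrightarrow> mul G l a (unit G) = a"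
    and mul_unit_left: "\<lbrakk>l \<in> \<Lambda>; a \<in> pts G\<rbrakk> \<Longrightarrow> mul G l (unit G) a = a"
    and act_unit: "l \<in> \<Lambda> \<Longrightarrow> act G (l, unit G) = l"
    and ex_inverse: "\<lbrakk>l \<in> \<Lambda>; a \<in> pts G\<rbrakk> \<Longrightarrow>
      \<exists>a'\<in>pts G. mul G l a a' = unit G \<and> mul G (act G (l, a)) a' a = unit G"

text \<open>
  For \<open>\<sigma> : \<Lambda> \<times> G \<times> H \<rightarrow> H \<times> G\<close>, the two components of \<open>\<sigma> (l, a, x)\<close>: \<open>lact \<sigma> l a x\<close> is
  \<open>a \<rightharpoonup>\<^sub>l x\<close> and \<open>ract \<sigma> l a x\<close> is \<open>a \<leftharpoonup>\<^sub>l x\<close>.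
\<close>

definition lact :: "('l \<times> 'g \<times> 'h \<Rightarrow> 'h \<times> 'g) \<Rightarrow> 'l \<Rightarrow> 'g \<Rightarrow> 'h \<Rightarrow> 'h"
  where "lact \<sigma> l a x = fst (\<sigma> (l, a, x))"

definition ract :: "('l \<times> 'g \<times> 'h \<Rightarrow> 'h \<times> 'g) \<Rightarrow> 'l \<Rightarrow> 'g \<Rightarrow> 'h \<Rightarrow> 'g"
  where "ract \<sigma> l a x = snd (\<sigma> (l, a, x))"

locale matched_pair = G: dynamical_group \<Lambda> G + H: dynamical_group \<Lambda> H
  for \<Lambda> :: "'l set"
    and G :: "('l, 'g, 'm) dyngroup_scheme"
    and H :: "('l, 'h, 'n) dyngroup_scheme" +
  fixes \<sigma> :: "'l \<times> 'g \<times> 'h \<Rightarrow> 'h \<times> 'g"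
  assumes morphism: "dyn_morphism \<Lambda> (tensor G H) (tensor H G) \<sigma>"
    and lact_unit: "\<lbrakk>l \<in> \<Lambda>; x \<in> pts H\<rbrakk> \<Longrightarrow> lact \<sigma> l (unit G) x = x"
    and lact_mul_left: "\<lbrakk>l \<in> \<Lambda>; a \<in> pts G; b \<in> pts G; x \<in> pts H\<rbrakk> \<Longrightarrow>
      lact \<sigma> l (mul G l a b) x = lact \<sigma> l a (lact \<sigma> (act G (l, a)) b x)"
    and lact_mul_right: "\<lbrakk>l \<in> \<Lambda>; a \<in> pts G; x \<in> pts H; y \<in> pts H\<rbrakk> \<Longrightarrow>
      lact \<sigma> l a (mul H (act G (l, a)) x y) =
      mul H l (lact \<sigma> l a x)
        (lact \<sigma> (act H (l, lact \<sigma> l a x)) (ract \<sigma> l a x) y)"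
    and ract_unit: "\<lbrakk>l \<in> \<Lambda>; a \<in> pts G\<rbrakk> \<Longrightarrow> ract \<sigma> l a (unit H) = a"
    and ract_mul_right: "\<lbrakk>l \<in> \<Lambda>; a \<in> pts G; x \<in> pts H; y \<in> pts H\<rbrakk> \<Longrightarrow>
      ract \<sigma> l a (mul H (act G (l, a)) x y) =
      ract \<sigma> (act H (l, lact \<sigma> l a x)) (ract \<sigma> l a x) y"
    and ract_mul_left: "\<lbrakk>l \<in> \<Lambda>; a \<in> pts G; b \<in> pts G; x \<in> pts H\<rbrakk> \<Longrightarrow>
      ract \<sigma> l (mul G l a b) x =
      mul G (act H (l, lact \<sigma> l (mul G l a b) x))
        (ract \<sigma> l a (lact \<sigma> (act G (l, a)) b x))
        (ract \<sigma> (act G (l, a)) b x)"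

locale braided_dynamical_group = matched_pair \<Lambda> G G \<sigma>
  for \<Lambda> :: "'l set"
    and G :: "('l, 'g, 'm) dyngroup_scheme"
    and \<sigma> :: "'l \<times> 'g \<times> 'g \<Rightarrow> 'g \<times> 'g" +
  assumes mul_braided: "\<lbrakk>l \<in> \<Lambda>; a \<in> pts G; b \<in> pts G\<rbrakk> \<Longrightarrow>
      mul G l (lact \<sigma> l a b) (ract \<sigma> l a b) = mul G l a b"


section \<open>Quiver-theoretical solutions of the Yang--Baxter equation\<close>

text \<open>
  A quiver over \<open>\<Lambda>\<close> is a directed multigraph with vertex set \<open>\<Lambda>\<close>, i.e. a
  \<^locale>\<open>wf_digraph\<close> with \<^const>\<open>tail\<close> as source and \<^const>\<open>head\<close> as target.
\<close>

definition composable2 :: "('v, 'a) pre_digraph \<Rightarrow> ('a \<times> 'a) set"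
  where "composable2 A = {(x, y). x \<in> arcs A \<and> y \<in> arcs A \<and> head A x = tail A y}"

definition composable3 :: "('v, 'a) pre_digraph \<Rightarrow> ('a \<times> 'a \<times> 'a) set"
  where "composable3 A = {(x, y, z). x \<in> arcs A \<and> y \<in> arcs A \<and> z \<in> arcs A \<and>
    head A x = tail A y \<and> head A y = tail A z}"

definition R12 :: "('a \<times> 'a \<Rightarrow> 'a \<times> 'a) \<Rightarrow> 'a \<times> 'a \<times> 'a \<Rightarrow> 'a \<times> 'a \<times> 'a"
  where "R12 R = (\<lambda>(x, y, z). (fst (R (x, y)), snd (R (x, y)), z))"

definition R23 :: "('a \<times> 'a \<Rightarrow> 'a \<times> 'a) \<Rightarrow> 'a \<times> 'a \<times> 'a \<Rightarrow> 'a \<times> 'a \<times> 'a"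
  where "R23 R = (\<lambda>(x, y, z). (x, R (y, z)))"

locale quiver_YBE_solution = wf_digraph A
  for A :: "('v, 'a) pre_digraph" +
  fixes R :: "'a \<times> 'a \<Rightarrow> 'a \<times> 'a"
  assumes bij: "bij_betw R (composable2 A) (composable2 A)"
    and tail_R: "(x, y) \<in> composable2 A \<Longrightarrow> tail A (fst (R (x, y))) = tail A x"
    and head_R: "(x, y) \<in> composable2 A \<Longrightarrow> head A (snd (R (x, y))) = head A y"
    and YBE: "t \<in> composable3 A \<Longrightarrow>
      R12 R (R23 R (R12 R t)) = R23 R (R12 R (R23 R t))"

locale nondegenerate_quiver_YBE_solution = quiver_YBE_solution A R
  for A :: "('v, 'a) pre_digraph" and R :: "'a \<times> 'a \<Rightarrow> 'a \<times> 'a" +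
  assumes left_nondegenerate: "x \<in> arcs A \<Longrightarrow>
      bij_betw (\<lambda>y. fst (R (x, y)))
        {y \<in> arcs A. tail A y = head A x} {y \<in> arcs A. tail A y = tail A x}"
    and right_nondegenerate: "y \<in> arcs A \<Longrightarrow>
      bij_betw (\<lambda>x. snd (R (x, y)))
        {x \<in> arcs A. head A x = tail A y} {x \<in> arcs A. head A x = head A y}"


section \<open>The functor from dynamical sets to quivers\<close>

definition Q :: "'l set \<Rightarrow> ('l, 'x, 'm) dynset_scheme \<Rightarrow> ('l, 'l \<times> 'x) pre_digraph"
  where "Q \<Lambda> X = \<lparr>verts = \<Lambda>, arcs = \<Lambda> \<times> pts X, tail = fst, head = act X\<rparr>"

definition Q_mor :: "('l \<times> 'x \<Rightarrow> 'y) \<Rightarrow> 'l \<times> 'x \<Rightarrow> 'l \<times> 'y"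
  where "Q_mor f = (\<lambda>(l, x). (l, f (l, x)))"

definition Q2 :: "('l \<times> 'x) \<times> ('l \<times> 'x) \<Rightarrow> 'l \<times> 'x \<times> 'x"
  where "Q2 = (\<lambda>((l, x), (_, y)). (l, x, y))"

definition sigma_hat ::
  "('l, 'g, 'm) dynset_scheme \<Rightarrow> ('l \<times> 'g \<times> 'g \<Rightarrow> 'g \<times> 'g) \<Rightarrow>
    ('l \<times> 'g) \<times> ('l \<times> 'g) \<Rightarrow> ('l \<times> 'g) \<times> ('l \<times> 'g)"
  where "sigma_hat G \<sigma> = (\<lambda>((l, a), (_, b)).
    ((l, lact \<sigma> l a b), (act G (l, lact \<sigma> l a b), ract \<sigma> l a b)))"

definition sigma_tilde ::
  "'l set \<Rightarrow> ('l, 'g, 'm) dynset_scheme \<Rightarrow> ('l \<times> 'g \<times> 'g \<Rightarrow> 'g \<times> 'g) \<Rightarrow>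
    ('l \<times> 'g) \<times> ('l \<times> 'g) \<Rightarrow> ('l \<times> 'g) \<times> ('l \<times> 'g)"
  where "sigma_tilde \<Lambda> G \<sigma> = inv_into (composable2 (Q \<Lambda> G)) Q2 \<circ> Q_mor \<sigma> \<circ> Q2"

text \<open>
  The next two facts show that the inverse and the composite in \<^const>\<open>sigma_tilde\<close> are
  the intended ones.
\<close>

lemma (in dynamical_set) bij_betw_Q2:
  "bij_betw Q2 (composable2 (Q \<Lambda> X)) (arcs (Q \<Lambda> (tensor X X)))"
proof (rule bij_betwI')
  fix p assume "p \<in> composable2 (Q \<Lambda> X)"
  then show "Q2 p \<in> arcs (Q \<Lambda> (tensor X X))"
    by (auto simp: composable2_def Q_def Q2_def tensor_def)
next
  fix p q assume "p \<in> composable2 (Q \<Lambda> X)" "q \<in> composable2 (Q \<Lambda> X)"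
  then show "(Q2 p = Q2 q) = (p = q)"
    by (auto simp: composable2_def Q_def Q2_def)
next
  fix t assume "t \<in> arcs (Q \<Lambda> (tensor X X))"
  then obtain l x y where t: "t = (l, x, y)" "l \<in> \<Lambda>" "x \<in> pts X" "y \<in> pts X"
    by (auto simp: Q_def tensor_def)
  then have "((l, x), (act X (l, x), y)) \<in> composable2 (Q \<Lambda> X)"
    using act_closed by (auto simp: composable2_def Q_def)
  moreover have "t = Q2 ((l, x), (act X (l, x), y))"
    using t by (simp add: Q2_def)
  ultimately show "\<exists>p\<in>composable2 (Q \<Lambda> X). t = Q2 p" by blast
qed

lemma Q_mor_arcs:
  assumes "dyn_morphism \<Lambda> X Y f"
  shows "Q_mor f \<in> arcs (Q \<Lambda> X) \<rightarrow> arcs (Q \<Lambda> Y)"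
  using assms by (auto simp: dyn_morphism_def Q_def Q_mor_def)

end

theory Submission
  imports Defs
begin

text \<open>
  The solution is the braiding of a braided groupoid on \<open>Q(\<G>)\<close>: since both actions are unital
  and compatible with composition, acting by inverses gives non-degeneracy and invertibility.
  Both sides of the Yang--Baxter equation have first entry \<open>xy \<rightharpoonup> z\<close> and last entry \<open>x \<leftharpoonup> yz\<close>,
  and since the braiding preserves composites, the middle entries agree by cancellation.

  The delicate point is unitality on the right. The axiom \<open>a \<leftharpoonup>\<^sub>\<lambda> e = a\<close> only compares labels;
  that \<open>(\<lambda>, a) \<leftharpoonup> 1\<close> also keeps its source needs \<open>a \<rightharpoonup>\<^sub>\<lambda> e = e\<close>. Put \<open>u = a \<rightharpoonup>\<^sub>\<lambda> e\<close> and
  \<open>\<mu> = \<phi>(\<lambda>, u)\<close>. Applying \<open>a \<rightharpoonup>\<^sub>\<lambda> -\<close> to \<open>e = e \<cdot> e\<close> gives \<open>a \<rightharpoonup>\<^sub>\<mu> e = e\<close>, and \<open>u \<circ>\<^sub>\<lambda> a = a\<close>, so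
  \<open>u \<rightharpoonup>\<^sub>\<lambda> e = u \<rightharpoonup>\<^sub>\<lambda> (a \<rightharpoonup>\<^sub>\<mu> e) = u\<close>; hence \<open>u \<circ>\<^sub>\<lambda> u = u\<close> and \<open>u = e\<close>.
\<close>

section \<open>Groupoids and cancellation of arrows\<close>

locale groupoid = wf_digraph A
  for A :: "('v, 'a) pre_digraph" +
  fixes comp :: "'a \<Rightarrow> 'a \<Rightarrow> 'a" (infixl "\<cdot>" 70)
    and one :: "'v \<Rightarrow> 'a"
  assumes comp_arc: "(x, y) \<in> composable2 A \<Longrightarrow> x \<cdot> y \<in> arcs A"
    and tail_comp: "(x, y) \<in> composable2 A \<Longrightarrow> tail A (x \<cdot> y) = tail A x"
    and head_comp: "(x, y) \<in> composable2 A \<Longrightarrow> head A (x \<cdot> y) = head A y"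
    and comp_assoc: "(x, y, z) \<in> composable3 A \<Longrightarrow> x \<cdot> y \<cdot> z = x \<cdot> (y \<cdot> z)"
    and one_arc: "v \<in> verts A \<Longrightarrow> one v \<in> arcs A"
    and tail_one: "v \<in> verts A \<Longrightarrow> tail A (one v) = v"
    and head_one: "v \<in> verts A \<Longrightarrow> head A (one v) = v"
    and one_comp: "x \<in> arcs A \<Longrightarrow> one (tail A x) \<cdot> x = x"
    and comp_one: "x \<in> arcs A \<Longrightarrow> x \<cdot> one (head A x) = x"
    and ex_inv: "x \<in> arcs A \<Longrightarrow> \<exists>x'\<in>arcs A. tail A x' = head A x \<and> head A x' = tail A x \<and>
      x \<cdot> x' = one (tail A x) \<and> x' \<cdot> x = one (head A x)"
begin

lemma comp_left_cancel:
  assumes xy: "(x, y) \<in> composable2 A" and xz: "(x, z) \<in> composable2 A"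
    and eq: "x \<cdot> y = x \<cdot> z"
  shows "y = z"
proof -
  have x: "x \<in> arcs A" using xy by (simp add: composable2_def)
  obtain x' where x': "x' \<in> arcs A" "head A x' = tail A x" "x' \<cdot> x = one (head A x)"
    using ex_inv[OF x] by blast
  have "w = x' \<cdot> (x \<cdot> w)" if "(x, w) \<in> composable2 A" for w
    using that x x' comp_assoc[of x' x w] one_comp[of w]
    by (simp add: composable2_def composable3_def)
  then show ?thesis using xy xz eq by metis
qed

lemma comp_right_cancel:
  assumes xz: "(x, z) \<in> composable2 A" and yz: "(y, z) \<in> composable2 A"
    and eq: "x \<cdot> z = y \<cdot> z"
  shows "x = y"
proof -
  have z: "z \<in> arcs A" using xz by (simp add: composable2_def)
  obtain z' where z': "z' \<in> arcs A" "tail A z' = head A z" "z \<cdot> z' = one (tail A z)"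
    using ex_inv[OF z] by blast
  have "w = w \<cdot> z \<cdot> z'" if "(w, z) \<in> composable2 A" for w
    using that z z' comp_assoc[of w z z'] comp_one[of w]
    by (simp add: composable2_def composable3_def)
  then show ?thesis using xz yz eq by metis
qed

end

section \<open>Braided groupoids and their braidings as solutions of the Yang-Baxter
  equation\<close>

locale braided_groupoid = groupoid A comp one
  for A :: "('v, 'a) pre_digraph" and comp (infixl "\<cdot>" 70) and one +
  fixes R :: "'a \<times> 'a \<Rightarrow> 'a \<times> 'a"
  assumes braiding_composable: "(x, y) \<in> composable2 A \<Longrightarrow> R (x, y) \<in> composable2 A"
    and tail_braiding: "(x, y) \<in> composable2 A \<Longrightarrow> tail A (fst (R (x, y))) = tail A x"
    and head_braiding: "(x, y) \<in> composable2 A \<Longrightarrow> head A (snd (R (x, y))) = head A y"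
    and left_one: "x \<in> arcs A \<Longrightarrow> fst (R (one (tail A x), x)) = x"
    and left_comp: "(x, y, z) \<in> composable3 A \<Longrightarrow>
      fst (R (x \<cdot> y, z)) = fst (R (x, fst (R (y, z))))"
    and left_of_comp: "(x, y, z) \<in> composable3 A \<Longrightarrow>
      fst (R (x, y \<cdot> z)) = fst (R (x, y)) \<cdot> fst (R (snd (R (x, y)), z))"
    and right_one: "x \<in> arcs A \<Longrightarrow> snd (R (x, one (head A x))) = x"
    and right_comp: "(x, y, z) \<in> composable3 A \<Longrightarrow>
      snd (R (x, y \<cdot> z)) = snd (R (snd (R (x, y)), z))"
    and comp_braiding: "(x, y) \<in> composable2 A \<Longrightarrow> fst (R (x, y)) \<cdot> snd (R (x, y)) = x \<cdot> y"
begin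

abbreviation left_action (infixr "\<rightharpoonup>" 75) where "x \<rightharpoonup> y \<equiv> fst (R (x, y))"
abbreviation right_action (infixl "\<leftharpoonup>" 75) where "x \<leftharpoonup> y \<equiv> snd (R (x, y))"

lemma actions:
  assumes "x \<in> arcs A" "y \<in> arcs A" "head A x = tail A y"
  shows "x \<rightharpoonup> y \<in> arcs A" "x \<leftharpoonup> y \<in> arcs A" "tail A (x \<rightharpoonup> y) = tail A x"
    "head A (x \<leftharpoonup> y) = head A y" "head A (x \<rightharpoonup> y) = tail A (x \<leftharpoonup> y)"
  using assms braiding_composable[of x y] tail_braiding[of x y] head_braiding[of x y]
  by (auto simp: composable2_def)

text \<open>By \<open>right_one\<close> the second output is \<open>x\<close> itself; since braiding
  preserves composites, both sides composed with \<open>x\<close> give \<open>x\<close>, which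
  cancels.\<close>

lemma left_action_one:
  assumes x: "x \<in> arcs A"
  shows "x \<rightharpoonup> one (head A x) = one (tail A x)"
proof (rule comp_right_cancel[where z = x])
  note one = one_arc[OF head_in_verts[OF x]] tail_one[OF head_in_verts[OF x]]
    one_arc[OF tail_in_verts[OF x]] head_one[OF tail_in_verts[OF x]]
  have c: "(x, one (head A x)) \<in> composable2 A"
    using x one by (simp add: composable2_def)
  show "(x \<rightharpoonup> one (head A x), x) \<in> composable2 A"
    using braiding_composable[OF c] right_one[OF x] by (metis prod.collapse)
  show "(one (tail A x), x) \<in> composable2 A"
    using x one by (simp add: composable2_def)
  show "(x \<rightharpoonup> one (head A x)) \<cdot> x = one (tail A x) \<cdot> x"
    using comp_braiding[OF c] right_one[OF x] one_comp[OF x] comp_one[OF x] by simp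
qed

lemma left_action_inverse:
  assumes "x \<in> arcs A" "x' \<in> arcs A" "head A x' = tail A x" "x' \<cdot> x = one (head A x)"
    and "y \<in> arcs A" "tail A y = head A x"
  shows "x' \<rightharpoonup> x \<rightharpoonup> y = y"
  using assms left_comp[of x' x y] left_one[of y] by (simp add: composable3_def)

text \<open>Take \<open>y \<cdot> y'\<close> as the second argument of both actions:
  \<open>right_comp\<close> and \<open>left_of_comp\<close> split the results, while
  \<open>right_one\<close> and \<open>left_action_one\<close> evaluate them at an identity. The
  first equation serves non-degeneracy, both together invert \<open>R\<close>.\<close>

lemma braiding_inverse_right:
  assumes x: "x \<in> arcs A" and y: "y \<in> arcs A" and xy: "head A x = tail A y"
    and y': "y' \<in> arcs A" "tail A y' = head A y" "y \<cdot> y' = one (tail A y)"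
  shows "x \<leftharpoonup> y \<leftharpoonup> y' = x" "(x \<rightharpoonup> y) \<cdot> ((x \<leftharpoonup> y) \<rightharpoonup> y') = one (tail A x)"
  using assms right_comp[of x y y'] right_one[of x] left_of_comp[of x y y'] left_action_one[of x]
  by (simp_all add: composable3_def)

lemma left_action_bij:
  assumes x: "x \<in> arcs A"
  shows "bij_betw (\<lambda>y. x \<rightharpoonup> y)
    {y \<in> arcs A. tail A y = head A x} {y \<in> arcs A. tail A y = tail A x}"
proof -
  obtain x' where x': "x' \<in> arcs A" "tail A x' = head A x" "head A x' = tail A x"
    "x \<cdot> x' = one (tail A x)" "x' \<cdot> x = one (head A x)"
    using ex_inv[OF x] by blast
  show ?thesis
    by (rule bij_betw_byWitness[where f' = "\<lambda>y. x' \<rightharpoonup> y"])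
      (use x x' left_action_inverse[of x x'] left_action_inverse[of x' x] actions in auto)
qed

lemma right_action_bij:
  assumes y: "y \<in> arcs A"
  shows "bij_betw (\<lambda>x. x \<leftharpoonup> y)
    {x \<in> arcs A. head A x = tail A y} {x \<in> arcs A. head A x = head A y}"
proof -
  obtain y' where y': "y' \<in> arcs A" "tail A y' = head A y" "head A y' = tail A y"
    "y \<cdot> y' = one (tail A y)" "y' \<cdot> y = one (head A y)"
    using ex_inv[OF y] by blast
  show ?thesis
    by (rule bij_betw_byWitness[where f' = "\<lambda>x. x \<leftharpoonup> y'"])
      (use y y' braiding_inverse_right(1)[of _ y y'] braiding_inverse_right(1)[of _ y' y] actions
        in auto)
qed

text \<open>
  If \<open>R (x, y) = (u, v)\<close> then \<open>R (v, y\<^sup>-\<^sup>1) = (u\<^sup>-\<^sup>1, x)\<close>; hence \<open>(u, v)\<close> determines \<open>y\<close> through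
  \<open>v \<rightharpoonup> y\<^sup>-\<^sup>1 = u\<^sup>-\<^sup>1\<close>, and then \<open>x\<close>.
\<close>
lemma braiding_bij: "bij_betw R (composable2 A) (composable2 A)"
proof (rule bij_betwI')
  fix p q assume p: "p \<in> composable2 A" and q: "q \<in> composable2 A"
  obtain x y z w where pq: "p = (x, y)" "q = (z, w)" by (cases p, cases q)
  have x: "x \<in> arcs A" "y \<in> arcs A" "head A x = tail A y"
    and z: "z \<in> arcs A" "w \<in> arcs A" "head A z = tail A w"
    using p q pq by (auto simp: composable2_def)
  show "(R p = R q) = (p = q)"
  proof
    assume eq: "R p = R q"
    define u v where "u = x \<rightharpoonup> y" and "v = x \<leftharpoonup> y"
    have u': "z \<rightharpoonup> w = u" "z \<leftharpoonup> w = v" using eq pq u_def v_def by simp_all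
    obtain y' where y': "y' \<in> arcs A" "tail A y' = head A y" "head A y' = tail A y"
      "y \<cdot> y' = one (tail A y)" "y' \<cdot> y = one (head A y)"
      using ex_inv[OF x(2)] by blast
    obtain w' where w': "w' \<in> arcs A" "tail A w' = head A w" "head A w' = tail A w"
      "w \<cdot> w' = one (tail A w)" "w' \<cdot> w = one (head A w)"
      using ex_inv[OF z(2)] by blast
    note a = actions[OF x, folded u_def v_def] and b = actions[OF z, unfolded u']
    have y'x: "v \<leftharpoonup> y' = x" "u \<cdot> (v \<rightharpoonup> y') = one (tail A x)"
      using braiding_inverse_right[OF x y'(1,2,4)] by (simp_all add: u_def v_def)
    have w'z: "v \<leftharpoonup> w' = z" "u \<cdot> (v \<rightharpoonup> w') = one (tail A z)"
      using braiding_inverse_right[OF z w'(1,2,4)] by (simp_all add: u')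
    have t: "tail A x = tail A z" "head A y = head A w" using a b by metis+
    \<comment> \<open>Both arrows are right inverses of \<open>u\<close>.\<close>
    have "v \<rightharpoonup> y' = v \<rightharpoonup> w'"
      by (rule comp_left_cancel[of u])
        (use a b y'x w'z y' w' t actions[of v y'] actions[of v w'] in
          \<open>auto simp: composable2_def\<close>)
    then have yw: "y' = w'"
      using bij_betw_imp_inj_on[OF left_action_bij[of v]] a b y' w' t
      by (auto simp: inj_on_def)
    then have xz: "x = z" using y'x w'z by simp
    \<comment> \<open>Both arrows have inverse \<open>y'\<close>; \<open>x = z\<close> gives them
      the same source, hence the same identity as composite with \<open>y'\<close>.\<close>
    have "y = w"
      by (rule comp_right_cancel[of _ y'])
        (use yw xz x z y' w' in \<open>auto simp: composable2_def\<close>)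
    then show "p = q" using pq xz by simp
  qed simp
next
  fix p assume "p \<in> composable2 A"
  then show "R p \<in> composable2 A" using braiding_composable by (cases p) simp
next
  fix p assume p: "p \<in> composable2 A"
  obtain u v where uv: "p = (u, v)" by (cases p)
  have u: "u \<in> arcs A" "v \<in> arcs A" "head A u = tail A v"
    using p uv by (auto simp: composable2_def)
  obtain u' where u': "u' \<in> arcs A" "tail A u' = head A u" "head A u' = tail A u"
    "u \<cdot> u' = one (tail A u)" "u' \<cdot> u = one (head A u)"
    using ex_inv[OF u(1)] by blast
  \<comment> \<open>For surjectivity the relation is run backwards: a preimage has second entry
    inverse to some \<open>z\<close> with \<open>v \<rightharpoonup> z = u'\<close>, and its first
    entry is \<open>v \<leftharpoonup> z\<close>.\<close>
  have "u' \<in> (\<lambda>z. v \<rightharpoonup> z) ` {z \<in> arcs A. tail A z = head A v}"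
    using bij_betw_imp_surj_on[OF left_action_bij[OF u(2)]] u u' by simp
  then obtain z where z: "z \<in> arcs A" "tail A z = head A v" "v \<rightharpoonup> z = u'"
    by blast
  obtain y where y: "y \<in> arcs A" "tail A y = head A z" "head A y = tail A z"
    "z \<cdot> y = one (tail A z)"
    using ex_inv[OF z(1)] by blast
  define x where "x = v \<leftharpoonup> z"
  have x: "x \<in> arcs A" "head A x = head A z" "tail A x = tail A u"
    using actions[OF u(2) z(1)] z(2,3) u' by (simp_all add: x_def)
  have i: "x \<leftharpoonup> y = v" "u' \<cdot> (x \<rightharpoonup> y) = one (tail A v)"
    using braiding_inverse_right[OF u(2) z(1) _ y(1,2,4)] z by (simp_all add: x_def)
  \<comment> \<open>Composing either side with \<open>u'\<close> on the left gives the identity at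
    \<open>tail A v\<close>.\<close>
  have "x \<rightharpoonup> y = u"
    by (rule comp_left_cancel[of u'])
      (use i u u' x y actions[of x y] in \<open>auto simp: composable2_def\<close>)
  then have "R (x, y) = p" using i uv by (metis prod.collapse)
  moreover have "(x, y) \<in> composable2 A" using x y by (simp add: composable2_def)
  ultimately show "\<exists>q\<in>composable2 A. p = R q" by blast
qed

lemma yang_baxter:
  assumes t: "t \<in> composable3 A"
  shows "R12 R (R23 R (R12 R t)) = R23 R (R12 R (R23 R t))"
proof -
  obtain x y z where xyz: "t = (x, y, z)" by (cases t)
  have x: "x \<in> arcs A" "y \<in> arcs A" "z \<in> arcs A" "head A x = tail A y" "head A y = tail A z"
    using t xyz by (auto simp: composable3_def)
  have t3: "(x, y, z) \<in> composable3 A" using t xyz by simp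
  \<comment> \<open>The left side runs through \<open>(p, q, z)\<close>, \<open>(p, r, s)\<close>,
    \<open>(f, m, s)\<close>; the right side through \<open>(x, b, c)\<close>,
    \<open>(f', d, c)\<close>, \<open>(f', m', s')\<close>.\<close>
  define p q where "p = x \<rightharpoonup> y" and "q = x \<leftharpoonup> y"
  define r s where "r = q \<rightharpoonup> z" and "s = q \<leftharpoonup> z"
  define f m where "f = p \<rightharpoonup> r" and "m = p \<leftharpoonup> r"
  define b c where "b = y \<rightharpoonup> z" and "c = y \<leftharpoonup> z"
  define f' d where "f' = x \<rightharpoonup> b" and "d = x \<leftharpoonup> b"
  define m' s' where "m' = d \<rightharpoonup> c" and "s' = d \<leftharpoonup> c"
  have pq: "p \<in> arcs A" "q \<in> arcs A" "tail A p = tail A x" "head A q = head A y"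
    "head A p = tail A q" "p \<cdot> q = x \<cdot> y"
    using actions[of x y] comp_braiding[of x y] x by (simp_all add: p_def q_def composable2_def)
  have rs: "r \<in> arcs A" "s \<in> arcs A" "tail A r = tail A q" "head A s = head A z"
    "head A r = tail A s" "r \<cdot> s = q \<cdot> z"
    using actions[of q z] comp_braiding[of q z] x pq by (simp_all add: r_def s_def composable2_def)
  have fm: "f \<in> arcs A" "m \<in> arcs A" "tail A f = tail A p" "head A m = head A r"
    "head A f = tail A m" "f \<cdot> m = p \<cdot> r"
    using actions[of p r] comp_braiding[of p r] pq rs by (simp_all add: f_def m_def composable2_def)
  have bc: "b \<in> arcs A" "c \<in> arcs A" "tail A b = tail A y" "head A c = head A z"
    "head A b = tail A c" "b \<cdot> c = y \<cdot> z"
    using actions[of y z] comp_braiding[of y z] x by (simp_all add: b_def c_def composable2_def)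
  have fd: "f' \<in> arcs A" "d \<in> arcs A" "tail A f' = tail A x" "head A d = head A b"
    "head A f' = tail A d" "f' \<cdot> d = x \<cdot> b"
    using actions[of x b] comp_braiding[of x b] x bc by (simp_all add: f'_def d_def composable2_def)
  have ms: "m' \<in> arcs A" "s' \<in> arcs A" "tail A m' = tail A d" "head A s' = head A c"
    "head A m' = tail A s'" "m' \<cdot> s' = d \<cdot> c"
    using actions[of d c] comp_braiding[of d c] bc fd by (simp_all add: m'_def s'_def composable2_def)
  \<comment> \<open>Preservation of composites turns \<open>p \<cdot> q\<close> into
    \<open>x \<cdot> y\<close>; \<open>left_comp\<close> then regroups the action.\<close>
  have "f = (p \<cdot> q) \<rightharpoonup> z"
    using left_comp[of p q z] pq x by (simp add: composable3_def f_def r_def)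
  then have ff: "f = f'"
    using left_comp[OF t3] pq by (simp add: f'_def b_def)
  \<comment> \<open>Dually, \<open>b \<cdot> c\<close> is \<open>y \<cdot> z\<close>.\<close>
  have "s' = x \<leftharpoonup> (b \<cdot> c)"
    using right_comp[of x b c] bc x by (simp add: composable3_def s'_def d_def)
  then have ss: "s = s'"
    using right_comp[OF t3] bc by (simp add: s_def q_def)
  \<comment> \<open>Every stage on either side has the same total composite, that of
    \<open>x\<close>, \<open>y\<close>, \<open>z\<close>.\<close>
  have "f \<cdot> m \<cdot> s = p \<cdot> (r \<cdot> s)"
    using comp_assoc[of p r s] fm pq rs by (simp add: composable3_def)
  also have "\<dots> = p \<cdot> q \<cdot> z"
    using comp_assoc[of p q z] rs pq x by (simp add: composable3_def)
  also have "\<dots> = x \<cdot> (b \<cdot> c)"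
    using comp_assoc[OF t3] pq bc by simp
  also have "\<dots> = f' \<cdot> d \<cdot> c"
    using comp_assoc[of x b c] fd bc x by (simp add: composable3_def)
  also have "\<dots> = f' \<cdot> m' \<cdot> s'"
    using comp_assoc[of f' d c] comp_assoc[of f' m' s'] ms fd bc by (simp add: composable3_def)
  finally have e: "f \<cdot> m \<cdot> s = f' \<cdot> m' \<cdot> s'" .
  have c: "(f, m) \<in> composable2 A" "(f', m') \<in> composable2 A"
    using fm fd ms by (simp_all add: composable2_def)
  \<comment> \<open>The common last entry cancels here, the common first entry next.\<close>
  have "f \<cdot> m = f' \<cdot> m'"
    by (rule comp_right_cancel[OF _ _ e[folded ss]])
      (use c comp_arc[OF c(1)] comp_arc[OF c(2)] head_comp[OF c(1)] head_comp[OF c(2)]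
        fm rs ms ss in \<open>simp_all add: composable2_def\<close>)
  then have mm: "m = m'"
    using comp_left_cancel c ff by metis
  have "R12 R (R23 R (R12 R t)) = (f, m, s)"
    by (simp add: xyz R12_def R23_def p_def q_def r_def s_def f_def m_def split: prod.split)
  moreover have "R23 R (R12 R (R23 R t)) = (f', m', s')"
    by (simp add: xyz R12_def R23_def b_def c_def f'_def d_def m'_def s'_def split: prod.split)
  ultimately show ?thesis using ff mm ss by simp
qed

theorem nondegenerate_solution: "nondegenerate_quiver_YBE_solution A R"
  by unfold_locales
    (use braiding_bij tail_braiding head_braiding yang_baxter left_action_bij right_action_bij
      in auto)

end

section \<open>From dynamical groups to groupoids\<close>

lemma (in dynamical_set) wf_digraph_Q: "wf_digraph (Q \<Lambda> X)"
  by unfold_locales (use act_closed in \<open>auto simp: Q_def\<close>)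

lemma (in dynamical_group) left_cancel:
  assumes "l \<in> \<Lambda>" "a \<in> pts G" "b \<in> pts G" "c \<in> pts G" "mul G l a b = mul G l a c"
  shows "b = c"
proof -
  obtain a' where a': "a' \<in> pts G" "mul G l a a' = unit G" "mul G (act G (l, a)) a' a = unit G"
    using ex_inverse assms by blast
  let ?m = "act G (l, a)"
  have m: "?m \<in> \<Lambda>" using act_closed assms by auto
  \<comment> \<open>Associativity at base \<open>?m\<close> moves the inner product to base
    \<open>act G (?m, a')\<close>; this must be \<open>l\<close> for it to be the given
    product.\<close>
  have "act G (?m, a') = l"
    using act_mul[of l a a'] a' assms act_unit by simp
  then have "d = mul G ?m a' (mul G l a d)" if "d \<in> pts G" for d
    using mul_assoc[of ?m a' a d] mul_unit_left[of ?m d] a' assms m that by simp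
  then show ?thesis using assms by metis
qed

text \<open>The second source is dropped because composability forces it to be
  \<open>act G (l, a)\<close>.\<close>

definition Q_comp :: "('l, 'g, 'm) dyngroup_scheme \<Rightarrow> 'l \<times> 'g \<Rightarrow> 'l \<times> 'g \<Rightarrow> 'l \<times> 'g"
  where "Q_comp G = (\<lambda>(l, a) (_, b). (l, mul G l a b))"

text \<open>The inverse of \<open>(l, a)\<close> is the label \<open>a'\<close> based at
  \<open>act G (l, a)\<close>; it ends at \<open>l\<close> because the unit acts trivially.\<close>

lemma (in dynamical_group) groupoid_Q:
  "groupoid (Q \<Lambda> G) (Q_comp G) (\<lambda>l. (l, unit G))"
proof -
  interpret wf_digraph "Q \<Lambda> G" by (rule wf_digraph_Q)
  show ?thesis
  proof
    fix x assume "x \<in> arcs (Q \<Lambda> G)"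
    then obtain l a where x: "x = (l, a)" "l \<in> \<Lambda>" "a \<in> pts G" by (auto simp: Q_def)
    then obtain a' where a': "a' \<in> pts G" "mul G l a a' = unit G"
      "mul G (act G (l, a)) a' a = unit G"
      using ex_inverse by blast
    have "act G (l, a) \<in> \<Lambda>" using act_closed x by auto
    moreover have "act G (act G (l, a), a') = l"
      using act_mul[of l a a'] a' x act_unit by simp
    ultimately show "\<exists>x'\<in>arcs (Q \<Lambda> G). tail (Q \<Lambda> G) x' = head (Q \<Lambda> G) x \<and>
      head (Q \<Lambda> G) x' = tail (Q \<Lambda> G) x \<and>
      Q_comp G x x' = (tail (Q \<Lambda> G) x, unit G) \<and> Q_comp G x' x = (head (Q \<Lambda> G) x, unit G)"
      using x a' by (intro bexI[of _ "(act G (l, a), a')"]) (auto simp: Q_def Q_comp_def)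
  qed (use mul_closed act_mul mul_assoc unit_closed mul_unit_right mul_unit_left act_unit act_closed
      in \<open>auto simp: Q_def Q_comp_def composable2_def composable3_def\<close>)
qed

section \<open>From braided dynamical groups to braided groupoids, and comparison of the two
  solutions\<close>

context braided_dynamical_group
begin

lemma lact_closed: "\<lbrakk>l \<in> \<Lambda>; a \<in> pts G; b \<in> pts G\<rbrakk> \<Longrightarrow> lact \<sigma> l a b \<in> pts G"
  and ract_closed: "\<lbrakk>l \<in> \<Lambda>; a \<in> pts G; b \<in> pts G\<rbrakk> \<Longrightarrow> ract \<sigma> l a b \<in> pts G"
  using morphism unfolding dyn_morphism_def tensor_def lact_def ract_def
  by (auto simp: Pi_iff mem_Times_iff)

text \<open>This is the morphism condition on \<open>\<sigma>\<close>; it makes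
  \<open>sigma_hat\<close> preserve the target of a composable pair.\<close>

lemma act_braiding:
  assumes "l \<in> \<Lambda>" "a \<in> pts G" "b \<in> pts G"
  shows "act G (act G (l, lact \<sigma> l a b), ract \<sigma> l a b) = act G (act G (l, a), b)"
  using assms morphism unfolding dyn_morphism_def tensor_def lact_def ract_def
  by (auto simp: case_prod_beta)

lemma act_in: "\<lbrakk>l \<in> \<Lambda>; a \<in> pts G\<rbrakk> \<Longrightarrow> act G (l, a) \<in> \<Lambda>"
  using G.act_closed by auto

lemma lact_of_unit:
  assumes l: "l \<in> \<Lambda>" and a: "a \<in> pts G"
  shows "lact \<sigma> l a (unit G) = unit G"
proof -
  note e = G.unit_closed
  define u where "u = lact \<sigma> l a (unit G)"
  define m where "m = act G (l, u)"
  have u: "u \<in> pts G" using lact_closed[OF l a e] by (simp add: u_def)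
  have m: "m \<in> \<Lambda>" using act_in[OF l u] by (simp add: m_def)
  have "u = mul G l u (lact \<sigma> m a (unit G))"
    using lact_mul_right[OF l a e e] ract_unit[OF l a] G.mul_unit_left[OF act_in[OF l a] e]
    by (simp add: u_def m_def)
  then have v: "lact \<sigma> m a (unit G) = unit G"
    using G.left_cancel[OF l u lact_closed[OF m a e] e] G.mul_unit_right[OF l u] by simp
  \<comment> \<open>The braiding sends the labels \<open>(a, e)\<close> to \<open>(u, a)\<close>
    and, two steps below, \<open>(u, e)\<close> to \<open>(u, u)\<close>; in both cases
    \<open>mul_braided\<close> compares the products.\<close>
  have "mul G l u a = a"
    using mul_braided[OF l a e] ract_unit[OF l a] G.mul_unit_right[OF l a] by (simp add: u_def)
  then have "lact \<sigma> l u (unit G) = u"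
    using lact_mul_left[OF l u a e] v by (simp add: u_def m_def)
  then have "mul G l u u = mul G l u (unit G)"
    using mul_braided[OF l u e] ract_unit[OF l u] by simp
  then show ?thesis using G.left_cancel[OF l u u e] by (simp add: u_def)
qed

text \<open>Beyond the label axioms, sources must agree: in \<open>right_one\<close> this is
  \<open>lact_of_unit\<close>, in \<open>right_comp\<close> it is \<open>lact_mul_right\<close> with
  \<open>act_mul\<close>.\<close>

lemma braided_groupoid_Q:
  "braided_groupoid (Q \<Lambda> G) (Q_comp G) (\<lambda>l. (l, unit G)) (sigma_hat G \<sigma>)"
proof -
  interpret groupoid "Q \<Lambda> G" "Q_comp G" "\<lambda>l. (l, unit G)" by (rule G.groupoid_Q)
  show ?thesis
    by unfold_locales
      (use lact_closed ract_closed act_in act_braiding lact_unit lact_of_unit lact_mul_left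
        lact_mul_right ract_unit ract_mul_right mul_braided G.act_unit G.act_mul in
        \<open>auto simp: Q_def Q_comp_def composable2_def composable3_def sigma_hat_def\<close>)
qed

text \<open>\<open>Q2\<close> intertwines \<open>sigma_hat\<close> with
  \<open>Q_mor \<sigma>\<close>, and it is injective on composable pairs, among which
  \<open>sigma_hat G \<sigma> p\<close> lies.\<close>

lemma sigma_hat_eq_sigma_tilde:
  assumes p: "p \<in> composable2 (Q \<Lambda> G)"
  shows "sigma_hat G \<sigma> p = sigma_tilde \<Lambda> G \<sigma> p"
proof -
  have "sigma_hat G \<sigma> p \<in> composable2 (Q \<Lambda> G)"
    using braided_groupoid.braiding_composable[OF braided_groupoid_Q] p by (cases p) simp
  then have "inv_into (composable2 (Q \<Lambda> G)) Q2 (Q2 (sigma_hat G \<sigma> p)) = sigma_hat G \<sigma> p"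
    using inv_into_f_f bij_betw_imp_inj_on[OF G.bij_betw_Q2] by metis
  moreover have "Q2 (sigma_hat G \<sigma> p) = Q_mor \<sigma> (Q2 p)"
    by (auto simp: Q2_def sigma_hat_def Q_mor_def lact_def ract_def split: prod.split)
  ultimately show ?thesis by (simp add: sigma_tilde_def)
qed

end

theorem corollary2p39:
  fixes \<Lambda> :: "'l set"
    and G :: "('l, 'g) dyngroup"
    and \<sigma> :: "'l \<times> 'g \<times> 'g \<Rightarrow> 'g \<times> 'g"
  assumes "braided_dynamical_group \<Lambda> G \<sigma>"
  shows "nondegenerate_quiver_YBE_solution (Q \<Lambda> G) (sigma_hat G \<sigma>) \<and>
    (\<forall>p \<in> composable2 (Q \<Lambda> G). sigma_hat G \<sigma> p = sigma_tilde \<Lambda> G \<sigma> p)"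
  using braided_groupoid.nondegenerate_solution[OF
      braided_dynamical_group.braided_groupoid_Q[OF assms]]
    braided_dynamical_group.sigma_hat_eq_sigma_tilde[OF assms] by blast

end
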